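(* Let $R$ be an orthogonal term rewriting system over a signature $\Sigma$, and let $\Sigma' \subseteq \Sigma$, such that every rule $\ell \to r$ of $R$ is of one of the following two shapes: (i) $\ell \to r$ is variable preserving (every variable occurring in $\ell$ occurs exactly once in $r$), and neither $\ell$ nor $r$ contains symbols from $\Sigma'$; (ii) the root symbol of $\ell$ is in $\Sigma'$, and for every occurrence in $r$ of a symbol from $\Sigma'$, the arguments of this occurrence do not contain defined symbols. Then for every basic term $t$, any two reductions of $t$ to normal form have the same length (number of rewrite steps).
   Context: Terms are first-order terms over $\Sigma$ and a set of variables; orthogonal means left-linear with no overlaps between left-hand sides, as standard. A symbol is a defined symbol if it occurs as the root symbol of the left-hand side of some rule of $R$. A term is basic if its root symbol is a defined symbol and this root is the only occurrence of a defined symbol in the term. A reduction is a finite sequence of one-step rewrites $\to_R$; a reduction of $t$ to normal form is a reduction starting in $t$ and ending in a term to which no rule of $R$ applies. *)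

theory Defs
  imports Main
begin

datatype (funs_trm: 'f, vars_trm: 'v) trm =
  Var 'v | Fun 'f "('f, 'v) trm list"

type_synonym ('f, 'v) subst = "'v \<Rightarrow> ('f, 'v) trm"
type_synonym ('f, 'v) rule = "('f, 'v) trm \<times> ('f, 'v) trm"

text \<open>A signature is a set \<open>F\<close> of symbols together with an arity function \<open>ar\<close>.\<close>

fun trm_over :: "'f set \<Rightarrow> ('f \<Rightarrow> nat) \<Rightarrow> ('f, 'v) trm \<Rightarrow> bool" where
  "trm_over F ar (Var x) \<longleftrightarrow> True"
| "trm_over F ar (Fun f ts) \<longleftrightarrow>
     f \<in> F \<and> length ts = ar f \<and> (\<forall>t\<in>set ts. trm_over F ar t)"

definition subst_over :: "'f set \<Rightarrow> ('f \<Rightarrow> nat) \<Rightarrow> ('f, 'v) subst \<Rightarrow> bool" where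
  "subst_over F ar \<sigma> \<longleftrightarrow> (\<forall>x. trm_over F ar (\<sigma> x))"

fun subst_apply :: "('f, 'v) trm \<Rightarrow> ('f, 'v) subst \<Rightarrow> ('f, 'v) trm" (infixl "\<cdot>" 67) where
  "Var x \<cdot> \<sigma> = \<sigma> x"
| "Fun f ts \<cdot> \<sigma> = Fun f (map (\<lambda>t. t \<cdot> \<sigma>) ts)"

fun subterms :: "('f, 'v) trm \<Rightarrow> ('f, 'v) trm set" where
  "subterms (Var x) = {Var x}"
| "subterms (Fun f ts) = insert (Fun f ts) (\<Union>t\<in>set ts. subterms t)"

text \<open>The variables of a term from left to right, with repetitions.\<close>

fun var_occs :: "('f, 'v) trm \<Rightarrow> 'v list" where
  "var_occs (Var x) = [x]"
| "var_occs (Fun f ts) = concat (map var_occs ts)"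

definition trs :: "'f set \<Rightarrow> ('f \<Rightarrow> nat) \<Rightarrow> ('f, 'v) rule set \<Rightarrow> bool" where
  "trs F ar R \<longleftrightarrow> (\<forall>(l, r)\<in>R. trm_over F ar l \<and> trm_over F ar r \<and>
     (\<forall>x. l \<noteq> Var x) \<and> vars_trm r \<subseteq> vars_trm l)"

inductive rstep :: "('f, 'v) rule set \<Rightarrow> ('f, 'v) trm \<Rightarrow> ('f, 'v) trm \<Rightarrow> bool"
  for R where
  root: "(l, r) \<in> R \<Longrightarrow> rstep R (l \<cdot> \<sigma>) (r \<cdot> \<sigma>)"
| arg: "rstep R s t \<Longrightarrow> rstep R (Fun f (ss @ s # us)) (Fun f (ss @ t # us))"

definition normal_form :: "('f, 'v) rule set \<Rightarrow> ('f, 'v) trm \<Rightarrow> bool" where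
  "normal_form R t \<longleftrightarrow> (\<nexists>u. rstep R t u)"

definition left_linear :: "('f, 'v) rule set \<Rightarrow> bool" where
  "left_linear R \<longleftrightarrow> (\<forall>(l, r)\<in>R. distinct (var_occs l))"

definition variant :: "('f, 'v) rule \<Rightarrow> ('f, 'v) rule \<Rightarrow> bool" where
  "variant p q \<longleftrightarrow> (\<exists>\<pi>. bij \<pi> \<and>
     fst q = fst p \<cdot> (\<lambda>x. Var (\<pi> x)) \<and> snd q = snd p \<cdot> (\<lambda>x. Var (\<pi> x)))"

text \<open>
  An overlap is a non-variable subterm of a left-hand side that has a common instance with a
  left-hand side. The use of two substitutions stands for renaming the rules apart. The trivial
  overlap of a rule with (a renaming of) itself at the root is excluded; the occurrence is at the
  root if and only if the subterm is the whole left-hand side.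
\<close>

definition non_overlapping :: "'f set \<Rightarrow> ('f \<Rightarrow> nat) \<Rightarrow> ('f, 'v) rule set \<Rightarrow> bool" where
  "non_overlapping F ar R \<longleftrightarrow>
     (\<forall>p\<in>R. \<forall>q\<in>R. \<forall>u\<in>subterms (fst p). \<forall>\<sigma> \<tau>.
        (\<forall>x. u \<noteq> Var x) \<and> subst_over F ar \<sigma> \<and> subst_over F ar \<tau> \<and> u \<cdot> \<sigma> = fst q \<cdot> \<tau>
        \<longrightarrow> u = fst p \<and> variant p q)"

definition orthogonal :: "'f set \<Rightarrow> ('f \<Rightarrow> nat) \<Rightarrow> ('f, 'v) rule set \<Rightarrow> bool" where
  "orthogonal F ar R \<longleftrightarrow> left_linear R \<and> non_overlapping F ar R"

definition defined_syms :: "('f, 'v) rule set \<Rightarrow> 'f set" where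
  "defined_syms R = {f. \<exists>ts r. (Fun f ts, r) \<in> R}"

definition basic :: "('f, 'v) rule set \<Rightarrow> ('f, 'v) trm \<Rightarrow> bool" where
  "basic R t \<longleftrightarrow> (\<exists>f ts. t = Fun f ts \<and> f \<in> defined_syms R \<and>
     (\<forall>u\<in>set ts. funs_trm u \<inter> defined_syms R = {}))"

definition variable_preserving :: "('f, 'v) rule \<Rightarrow> bool" where
  "variable_preserving p \<longleftrightarrow> (\<forall>x\<in>vars_trm (fst p). count_list (var_occs (snd p)) x = 1)"

definition shape_i :: "'f set \<Rightarrow> ('f, 'v) rule \<Rightarrow> bool" where
  "shape_i S p \<longleftrightarrow> variable_preserving p \<and>
     funs_trm (fst p) \<inter> S = {} \<and> funs_trm (snd p) \<inter> S = {}"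

definition shape_ii :: "('f, 'v) rule set \<Rightarrow> 'f set \<Rightarrow> ('f, 'v) rule \<Rightarrow> bool" where
  "shape_ii R S p \<longleftrightarrow> (\<exists>f ts. fst p = Fun f ts \<and> f \<in> S) \<and>
     (\<forall>g us. Fun g us \<in> subterms (snd p) \<and> g \<in> S \<longrightarrow>
        (\<forall>u\<in>set us. funs_trm u \<inter> defined_syms R = {}))"

end

theory Submission
  imports Defs
begin

text \<open>
  Call a term good if the arguments of its \<open>S\<close>-rooted subterms contain no defined symbols. Basic terms
  are good and rewriting preserves goodness. In a good term the redexes of rules of shape (ii) have
  normal arguments, and the rules of shape (i) neither copy nor erase the redexes in their
  arguments. Hence, by orthogonality, two different steps from a good term can be joined by
  exactly one step on each side, and this diamond property forces all reductions to normal form to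
  have the same length.
\<close>

section \<open>Random descent\<close>

lemma relpowp_Suc_iff: "(r ^^ Suc n) x z \<longleftrightarrow> (\<exists>y. r x y \<and> (r ^^ n) y z)"
  by (metis relpowp_Suc_D2 relpowp_Suc_I2)

text \<open>Induction on the length. If the given reduction starts with \<open>a\<close>, then
  \<open>a\<close> and \<open>y\<close> agree or meet after one step in some \<open>w\<close>. The
  induction hypothesis at \<open>a\<close> gives \<open>n\<close> steps from \<open>w\<close> to
  \<open>u\<close>, and the step from \<open>y\<close> to \<open>w\<close> restores the
  count.\<close>

lemma diamond_step_towards_normal_form:
  assumes inv: "\<And>x y. P x \<Longrightarrow> r x y \<Longrightarrow> P y"
    and diamond: "\<And>x y z. P x \<Longrightarrow> r x y \<Longrightarrow> r x z \<Longrightarrow> y = z \<or> (\<exists>w. r y w \<and> r z w)"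
    and nf: "\<nexists>y. r u y"
  shows "P x \<Longrightarrow> (r ^^ Suc n) x u \<Longrightarrow> r x y \<Longrightarrow> (r ^^ n) y u"
proof (induction n arbitrary: x y)
  case 0
  then have "r x u" by (simp add: relcompp_apply)
  \<comment> \<open>No step leaves \<open>u\<close>, so the peak at \<open>x\<close> can only close
    by \<open>y = u\<close>.\<close>
  with 0 diamond nf show ?case by (metis relpowp_0_I)
next
  case (Suc n)
  then obtain a where a: "r x a" "(r ^^ Suc n) a u"
    by (metis relpowp_Suc_iff)
  consider "a = y" | w where "r a w" "r y w"
    using diamond Suc.prems a(1) by blast
  then show ?case
  proof cases
    case 2
    then have "(r ^^ n) w u"
      using Suc.IH a Suc.prems inv by blast
    with 2 show ?thesis by (metis relpowp_Suc_I2)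
  qed (use a in simp)
qed

text \<open>By the previous lemma, the first step of the reduction to \<open>v\<close> also begins a
  reduction to \<open>u\<close> of length \<open>m\<close>. Removing it from both gives the
  induction.\<close>

lemma diamond_random_descent:
  assumes inv: "\<And>x y. P x \<Longrightarrow> r x y \<Longrightarrow> P y"
    and diamond: "\<And>x y z. P x \<Longrightarrow> r x y \<Longrightarrow> r x z \<Longrightarrow> y = z \<or> (\<exists>w. r y w \<and> r z w)"
    and nf: "\<nexists>y. r u y" "\<nexists>y. r v y"
  shows "P x \<Longrightarrow> (r ^^ m) x u \<Longrightarrow> (r ^^ n) x v \<Longrightarrow> m = n"
proof (induction n arbitrary: x m)
  case 0
  then show ?case
    using nf by (cases m) (auto simp: relpowp_Suc_iff simp del: relpowp.simps(2))
next
  case (Suc n)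
  then obtain y where y: "r x y" "(r ^^ n) y v"
    by (metis relpowp_Suc_iff)
  with Suc.prems nf obtain k where k: "m = Suc k"
    by (cases m) auto
  have "(r ^^ k) y u"
    by (rule diamond_step_towards_normal_form[where P = P and r = r, OF inv diamond nf(1)])
      (use Suc.prems y k in auto)
  with Suc.IH[of y k] inv Suc.prems(1) y k show ?case by blast
qed

section \<open>Terms, substitutions and rewrite steps\<close>

lemma set_var_occs [simp]: "set (var_occs t) = vars_trm t"
  by (induction t) auto

lemma subst_apply_cong: "(\<And>x. x \<in> vars_trm t \<Longrightarrow> \<sigma> x = \<tau> x) \<Longrightarrow> t \<cdot> \<sigma> = t \<cdot> \<tau>"
  by (induction t) auto

lemma subst_apply_eqD: "t \<cdot> \<sigma> = t \<cdot> \<tau> \<Longrightarrow> x \<in> vars_trm t \<Longrightarrow> \<sigma> x = \<tau> x"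
  by (induction t) auto

lemma subst_apply_rename: "t \<cdot> (\<lambda>x. Var (f x)) \<cdot> \<sigma> = t \<cdot> (\<lambda>x. \<sigma> (f x))"
  by (induction t) auto

lemma subst_apply_upd_fresh: "x \<notin> vars_trm t \<Longrightarrow> t \<cdot> \<sigma>(x := s) = t \<cdot> \<sigma>"
  by (rule subst_apply_cong) auto

lemma funs_trm_subst: "funs_trm (t \<cdot> \<sigma>) = funs_trm t \<union> (\<Union>x\<in>vars_trm t. funs_trm (\<sigma> x))"
  by (induction t) auto

lemma trm_over_subst:
  "trm_over F ar (t \<cdot> \<sigma>) \<longleftrightarrow> trm_over F ar t \<and> (\<forall>x\<in>vars_trm t. trm_over F ar (\<sigma> x))"
  by (induction t) auto

lemma subterms_refl: "t \<in> subterms t"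
  by (cases t) auto

lemma size_subterms: "s \<in> subterms t \<Longrightarrow> size s \<le> size t"
  by (induction t) (auto simp: size_list_estimation' le_SucI)

lemma funs_subterms: "s \<in> subterms t \<Longrightarrow> funs_trm s \<subseteq> funs_trm t"
  by (induction t) auto

lemma Fun_in_subterms_subst:
  "Fun g us \<in> subterms (t \<cdot> \<sigma>) \<Longrightarrow>
    (\<exists>vs. Fun g vs \<in> subterms t \<and> us = map (\<lambda>v. v \<cdot> \<sigma>) vs) \<or>
    (\<exists>x\<in>vars_trm t. Fun g us \<in> subterms (\<sigma> x))"
  by (induction t) fastforce+

text \<open>The sole occurrence of \<open>x\<close> lies in one argument, and the others do not see
  the change of \<sigma>. Exactly one step is needed, which is what variable preservation provides
  for right-hand sides.\<close>

lemma rstep_subst_upd: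
  assumes "rstep R (\<sigma> x) s"
  shows "count_list (var_occs t) x = 1 \<Longrightarrow> rstep R (t \<cdot> \<sigma>) (t \<cdot> \<sigma>(x := s))"
proof (induction t)
  case (Var y)
  then show ?case using assms by (auto split: if_splits)
next
  case (Fun f ts)
  have "x \<in> vars_trm (Fun f ts)"
    using Fun.prems by (metis count_notin set_var_occs zero_neq_one)
  then obtain us t vs where ts: "ts = us @ t # vs" and x: "x \<in> vars_trm t"
    by (auto dest: split_list)
  have "count_list (var_occs t) x \<noteq> 0"
    using x by (simp add: count_list_0_iff)
  with Fun.prems ts have t: "count_list (var_occs t) x = 1"
    and "count_list (concat (map var_occs us)) x = 0"
    and "count_list (concat (map var_occs vs)) x = 0"
    by auto
  then have "map (\<lambda>t. t \<cdot> \<sigma>(x := s)) us = map (\<lambda>t. t \<cdot> \<sigma>) us"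
    and "map (\<lambda>t. t \<cdot> \<sigma>(x := s)) vs = map (\<lambda>t. t \<cdot> \<sigma>) vs"
    by (auto simp: count_list_0_iff intro!: subst_apply_upd_fresh)
  with rstep.arg[OF Fun.IH[of t]] t ts show ?case
    by (simp add: map_eq_conv[THEN iffD2] del: fun_upd_apply map_eq_conv)
qed

lemma subst_apply_upd_linear_arg:
  assumes "distinct (var_occs (Fun f (us @ t # vs)))" and "x \<in> vars_trm t"
  shows "Fun f (us @ t # vs) \<cdot> \<sigma>(x := s) =
    Fun f (map (\<lambda>t. t \<cdot> \<sigma>) us @ t \<cdot> \<sigma>(x := s) # map (\<lambda>t. t \<cdot> \<sigma>) vs)"
  using assms by (auto intro!: subst_apply_upd_fresh)

text \<open>The second alternative is an overlap as soon as \<open>t\<close> occurs in a left-hand side.\<close>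

lemma rstep_linear_instance_cases:
  assumes "rstep R (t \<cdot> \<sigma>) v" and "distinct (var_occs t)" and "trm_over F ar (t \<cdot> \<sigma>)"
  obtains (var) x s where "x \<in> vars_trm t" and "rstep R (\<sigma> x) s" and "v = t \<cdot> \<sigma>(x := s)"
  | (overlap) u l r \<tau> where "u \<in> subterms t" and "\<forall>x. u \<noteq> Var x" and "(l, r) \<in> R"
      and "u \<cdot> \<sigma> = l \<cdot> \<tau>" and "trm_over F ar (u \<cdot> \<sigma>)"
      and "u = t \<Longrightarrow> v = r \<cdot> \<tau>"
  using assms
proof (induction t arbitrary: v thesis)
  case (Var y)
  show ?case by (rule Var.prems(1)[of y v]) (use Var.prems in auto)
next
  case (Fun f ts)
  from Fun.prems(3) show ?case
  proof cases
    case (root l r \<tau>)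
    show ?thesis
      by (rule Fun.prems(2)[of "Fun f ts" l r \<tau>]) (use root Fun.prems in auto)
  next
    case (arg a b g ss us)
    then obtain ss' t us' where ts: "ts = ss' @ t # us'" "ss = map (\<lambda>t. t \<cdot> \<sigma>) ss'"
        "a = t \<cdot> \<sigma>" "us = map (\<lambda>t. t \<cdot> \<sigma>) us'"
      by (auto simp: map_eq_append_conv map_eq_Cons_conv)
    have t: "t \<in> set ts" "rstep R (t \<cdot> \<sigma>) b" "distinct (var_occs t)" "trm_over F ar (t \<cdot> \<sigma>)"
      using arg ts Fun.prems by auto
    show ?thesis
    proof (rule Fun.IH[OF t(1) _ _ t(2-4)])
      fix x s
      assume x: "x \<in> vars_trm t" "rstep R (\<sigma> x) s" "b = t \<cdot> \<sigma>(x := s)"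
      have "v = Fun f (map (\<lambda>t. t \<cdot> \<sigma>) ss' @ t \<cdot> \<sigma>(x := s) # map (\<lambda>t. t \<cdot> \<sigma>) us')"
        using arg ts x(3) by simp
      also have "\<dots> = Fun f ts \<cdot> \<sigma>(x := s)"
        using subst_apply_upd_linear_arg[OF Fun.prems(4)[unfolded ts(1)] x(1)] ts(1) by simp
      finally show thesis
        using Fun.prems(1)[OF _ x(2)] x(1) t(1) by (meson trm.set_intros(4))
    next
      fix u l r \<tau>
      assume "u \<in> subterms t" "\<forall>x. u \<noteq> Var x" "(l, r) \<in> R"
        "u \<cdot> \<sigma> = l \<cdot> \<tau>" "trm_over F ar (u \<cdot> \<sigma>)"
      \<comment> \<open>Since \<open>u\<close> sits inside an argument, it is smaller than the whole
        term, and the claim about steps at the root is vacuous.\<close>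
      moreover from this t(1) have "u \<in> subterms (Fun f ts)" "u \<noteq> Fun f ts"
        using size_subterms size_list_estimation'[OF t(1), of "size t" size] by fastforce+
      ultimately show thesis
        using Fun.prems(2)[of u l r \<tau>] by blast
    qed
  qed
qed

lemma rstep_trm_over:
  assumes "trs F ar R"
  shows "rstep R s t \<Longrightarrow> trm_over F ar s \<Longrightarrow> trm_over F ar t"
proof (induction rule: rstep.induct)
  case (root l r \<sigma>)
  then show ?case using assms by (fastforce simp: trs_def trm_over_subst)
qed auto

text \<open>Left-hand sides are not variables, so every redex has a defined symbol at its root. The
  use is contrapositive: terms without defined symbols are normal.\<close>

lemma rstep_defined_syms:
  assumes "trs F ar R"
  shows "rstep R s t \<Longrightarrow> funs_trm s \<inter> defined_syms R \<noteq> {}"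
proof (induction rule: rstep.induct)
  case (root l r \<sigma>)
  moreover from this assms obtain f ts where "l = Fun f ts"
    by (cases l) (auto simp: trs_def)
  ultimately show ?case by (auto simp: defined_syms_def)
qed auto

lemma non_overlappingD:
  assumes "non_overlapping F ar R" and "(l, r) \<in> R" and "(l', r') \<in> R"
    and "u \<in> subterms l" and "\<forall>x. u \<noteq> Var x"
    and eq: "u \<cdot> \<sigma> = l' \<cdot> \<tau>" and over: "trm_over F ar (u \<cdot> \<sigma>)"
  shows "u = l" and "variant (l, r) (l', r')"
proof -
  txt \<open>\<^const>\<open>non_overlapping\<close> constrains the substitutions on all variables, so restrict them first.\<close>
  define \<sigma>' where "\<sigma>' x = (if x \<in> vars_trm u then \<sigma> x else Var x)" for x
  define \<tau>' where "\<tau>' x = (if x \<in> vars_trm l' then \<tau> x else Var x)" for x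
  have "u \<cdot> \<sigma>' = u \<cdot> \<sigma>" "l' \<cdot> \<tau>' = l' \<cdot> \<tau>"
    by (auto simp: \<sigma>'_def \<tau>'_def intro: subst_apply_cong)
  moreover have "subst_over F ar \<sigma>'" "subst_over F ar \<tau>'"
    using over over[unfolded eq] by (simp_all add: subst_over_def \<sigma>'_def \<tau>'_def trm_over_subst)
  ultimately show "u = l" "variant (l, r) (l', r')"
    using assms(1)[unfolded non_overlapping_def, rule_format, OF assms(2,3), of u \<sigma>' \<tau>'] assms(4-6)
    by simp_all
qed

text \<open>The two rules are variants, and a matching substitution is determined on the variables
  of \<open>l\<close>, which include those of \<open>r\<close>.\<close>

lemma root_steps_eq:
  assumes "trs F ar R" and "non_overlapping F ar R" and "(l, r) \<in> R" and "(l', r') \<in> R"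
    and eq: "l \<cdot> \<sigma> = l' \<cdot> \<tau>" and "trm_over F ar (l \<cdot> \<sigma>)"
  shows "r \<cdot> \<sigma> = r' \<cdot> \<tau>"
proof -
  have l: "\<forall>x. l \<noteq> Var x" and r: "vars_trm r \<subseteq> vars_trm l"
    using assms by (auto simp: trs_def)
  have "variant (l, r) (l', r')"
    by (rule non_overlappingD(2)[OF assms(2-4) subterms_refl l eq assms(6)])
  then obtain \<pi> where \<pi>: "l' = l \<cdot> (\<lambda>x. Var (\<pi> x))" "r' = r \<cdot> (\<lambda>x. Var (\<pi> x))"
    by (auto simp: variant_def)
  have "l \<cdot> \<sigma> = l \<cdot> (\<lambda>x. \<tau> (\<pi> x))"
    using eq \<pi> by (simp add: subst_apply_rename)
  then have "r \<cdot> \<sigma> = r \<cdot> (\<lambda>x. \<tau> (\<pi> x))"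
    using r by (meson subst_apply_cong subst_apply_eqD subsetD)
  with \<pi> show ?thesis by (simp add: subst_apply_rename)
qed

section \<open>Good terms and the diamond property\<close>

text \<open>The condition that \<open>shape_ii\<close> puts on right-hand sides, imposed on
  arbitrary terms to serve as an invariant.\<close>

definition good :: "('f, 'v) rule set \<Rightarrow> 'f set \<Rightarrow> ('f, 'v) trm \<Rightarrow> bool" where
  "good R S t \<longleftrightarrow> (\<forall>g us. Fun g us \<in> subterms t \<and> g \<in> S \<longrightarrow>
     (\<forall>u\<in>set us. funs_trm u \<inter> defined_syms R = {}))"

lemma good_Fun:
  "good R S (Fun f ts) \<longleftrightarrow> (\<forall>t\<in>set ts. good R S t) \<and>
     (f \<in> S \<longrightarrow> (\<forall>t\<in>set ts. funs_trm t \<inter> defined_syms R = {}))"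
  by (auto simp: good_def) blast+

lemma good_subst_var: "good R S (t \<cdot> \<sigma>) \<Longrightarrow> x \<in> vars_trm t \<Longrightarrow> good R S (\<sigma> x)"
  by (induction t) (auto simp: good_Fun)

lemma good_if_no_defined_syms: "funs_trm t \<inter> defined_syms R = {} \<Longrightarrow> good R S t"
proof (induction t)
  case (Var x)
  then show ?case by (simp add: good_def)
next
  case (Fun f ts)
  then have "\<forall>t\<in>set ts. funs_trm t \<inter> defined_syms R = {}" by auto
  with Fun.IH show ?case by (simp add: good_Fun)
qed

lemma good_basic: "basic R t \<Longrightarrow> good R S t"
  by (auto simp: basic_def good_Fun good_if_no_defined_syms)

text \<open>As \<open>r\<close> has no symbol from \<open>S\<close>, each \<open>S\<close>-rooted
  subterm of the result lies in some \<open>\<sigma> x\<close>, which already occurs in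
  \<open>l \<cdot> \<sigma>\<close>.\<close>

lemma good_shape_i_step:
  assumes "shape_i S (l, r)" and "vars_trm r \<subseteq> vars_trm l" and "good R S (l \<cdot> \<sigma>)"
  shows "good R S (r \<cdot> \<sigma>)"
  unfolding good_def
proof (intro allI impI, elim conjE)
  fix g us
  assume g: "Fun g us \<in> subterms (r \<cdot> \<sigma>)" "g \<in> S"
  have "Fun g vs \<notin> subterms r" for vs
    using assms(1) g(2) funs_subterms[of "Fun g vs" r] by (auto simp: shape_i_def)
  with Fun_in_subterms_subst[OF g(1)] obtain x
    where "x \<in> vars_trm r" "Fun g us \<in> subterms (\<sigma> x)"
    by blast
  moreover from this have "good R S (\<sigma> x)"
    using good_subst_var[OF assms(3)] assms(2) by blast
  ultimately show "\<forall>u\<in>set us. funs_trm u \<inter> defined_syms R = {}"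
    using g(2) unfolding good_def by blast
qed

text \<open>The root of \<open>l\<close> is in \<open>S\<close>, so goodness frees all substituted
  terms of defined symbols. Instantiating \<open>r\<close> thus adds none below its
  \<open>S\<close>-symbols.\<close>

lemma good_shape_ii_step:
  assumes "shape_ii R S (l, r)" and "vars_trm r \<subseteq> vars_trm l" and "good R S (l \<cdot> \<sigma>)"
  shows "good R S (r \<cdot> \<sigma>)"
  unfolding good_def
proof (intro allI impI, elim conjE)
  fix g us
  assume g: "Fun g us \<in> subterms (r \<cdot> \<sigma>)" "g \<in> S"
  have \<sigma>: "funs_trm (\<sigma> x) \<inter> defined_syms R = {}" if "x \<in> vars_trm r" for x
  proof -
    obtain f ts where l: "l = Fun f ts" "f \<in> S"
      using assms(1) by (auto simp: shape_ii_def)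
    with that assms(2) obtain t where t: "t \<in> set ts" "x \<in> vars_trm t" by auto
    have "funs_trm (t \<cdot> \<sigma>) \<inter> defined_syms R = {}"
      using assms(3) l t by (auto simp: good_Fun)
    with t(2) show ?thesis by (auto simp: funs_trm_subst)
  qed
  from Fun_in_subterms_subst[OF g(1)]
  consider vs where "Fun g vs \<in> subterms r" "us = map (\<lambda>v. v \<cdot> \<sigma>) vs"
    | x where "x \<in> vars_trm r" "Fun g us \<in> subterms (\<sigma> x)"
    by blast
  then show "\<forall>u\<in>set us. funs_trm u \<inter> defined_syms R = {}"
  proof cases
    case 1
    have "vars_trm v \<subseteq> vars_trm r" if "v \<in> set vs" for v
    proof -
      have "Fun g vs \<in> subterms t \<Longrightarrow> vars_trm v \<subseteq> vars_trm t" for t :: "('a, 'b) trm"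
        using that by (induction t) auto
      with 1 show ?thesis by blast
    qed
    moreover have "\<forall>v\<in>set vs. funs_trm v \<inter> defined_syms R = {}"
      using assms(1) 1 g(2) by (simp add: shape_ii_def)
    ultimately show ?thesis
      using 1 \<sigma> by (fastforce simp: funs_trm_subst)
  next
    case 2
    then show ?thesis
      using good_if_no_defined_syms[OF \<sigma>, of x S] g(2) unfolding good_def by blast
  qed
qed

section \<open>Invariance of goodness and the one-step diamond\<close>

locale orthogonal_shaped_trs =
  fixes F S :: "'f set" and ar :: "'f \<Rightarrow> nat" and R :: "('f, 'v) rule set"
  assumes trs: "trs F ar R" and orthogonal: "orthogonal F ar R"
    and shapes: "\<forall>p\<in>R. shape_i S p \<or> shape_ii R S p"
begin

lemma rule_vars: "(l, r) \<in> R \<Longrightarrow> vars_trm r \<subseteq> vars_trm l"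
  using trs by (auto simp: trs_def)

lemma rstep_good: "rstep R s t \<Longrightarrow> good R S s \<Longrightarrow> good R S t"
proof (induction rule: rstep.induct)
  case (root l r \<sigma>)
  then show ?case
    using shapes rule_vars good_shape_i_step good_shape_ii_step by metis
next
  case (arg s t f ss us)
  \<comment> \<open>The inner step needs a defined symbol in an argument of
    \<open>f\<close>.\<close>
  then have "f \<notin> S"
    using rstep_defined_syms[OF trs arg.hyps] by (auto simp: good_Fun)
  with arg show ?case by (auto simp: good_Fun)
qed

text \<open>By orthogonality the other step is either the same root step or takes place inside some
  \<open>\<sigma> x\<close>, where it commutes with the root step.\<close>

lemma root_peak:
  assumes rule: "(l, r) \<in> R" and step: "rstep R (l \<cdot> \<sigma>) v"
    and over: "trm_over F ar (l \<cdot> \<sigma>)" and good: "good R S (l \<cdot> \<sigma>)"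
  shows "v = r \<cdot> \<sigma> \<or> (\<exists>w. rstep R (r \<cdot> \<sigma>) w \<and> rstep R v w)"
proof -
  have linear: "distinct (var_occs l)" and no: "non_overlapping F ar R"
    using orthogonal rule by (auto simp: orthogonal_def left_linear_def)
  from step linear over show ?thesis
  proof (cases rule: rstep_linear_instance_cases)
    case (var x s)
    \<comment> \<open>Under a rule of shape (ii), goodness would make \<open>\<sigma> x\<close>
      normal.\<close>
    have "shape_i S (l, r)"
    proof (rule ccontr)
      assume "\<not> shape_i S (l, r)"
      with shapes rule obtain f ts where l: "l = Fun f ts" "f \<in> S"
        by (auto simp: shape_ii_def)
      with var(1) obtain t where t: "t \<in> set ts" "x \<in> vars_trm t" by auto
      then have "funs_trm (\<sigma> x) \<inter> defined_syms R = {}"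
        using good l by (fastforce simp: good_Fun funs_trm_subst)
      with rstep_defined_syms[OF trs var(2)] show False by simp
    qed
    then have "count_list (var_occs r) x = 1"
      using var(1) by (auto simp: shape_i_def variable_preserving_def)
    \<comment> \<open>The common reduct is \<open>r \<cdot> \<sigma>(x := s)\<close>: one step
      inside \<open>r \<cdot> \<sigma>\<close> reaches it, and so does the same rule at the root of
      \<open>v\<close>.\<close>
    from rstep_subst_upd[of R \<sigma> x s r, OF var(2) this] var(3) rule show ?thesis
      by (auto intro: rstep.root)
  next
    case (overlap u l' r' \<tau>)
    then have "u = l"
      using non_overlappingD(1)[OF no rule] by metis
    with overlap show ?thesis
      using root_steps_eq[OF trs no rule] by metis
  qed
qed

lemma diamond:
  assumes "rstep R s t"
  shows "rstep R s v \<Longrightarrow> trm_over F ar s \<Longrightarrow> good R S s \<Longrightarrow>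
    t = v \<or> (\<exists>w. rstep R t w \<and> rstep R v w)"
  using assms
proof (induction arbitrary: v rule: rstep.induct[consumes 1])
  case (root l r \<sigma>)
  then show ?case using root_peak by metis
next
  case (arg s t f ss us)
  note step = rstep.arg[OF arg.hyps, of f ss us]
  from arg.prems(1) show ?case
  proof cases
    case (root l r \<sigma>)
    then show ?thesis
      using root_peak[OF root(3)] step arg.prems by metis
  next
    case inner: (arg a b ss' us')
    \<comment> \<open>The second redex lies in the same argument, in one further left, or in one
      further right. Steps in distinct arguments commute.\<close>
    from inner consider
        "ss = ss'" "s = a" "us = us'"
      | ws where "ss = ss' @ a # ws" "us' = ws @ s # us"
      | ws where "ss' = ss @ s # ws" "us = ws @ a # us'"
      by (auto simp: append_eq_append_conv2 append_eq_Cons_conv Cons_eq_append_conv)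
    then show ?thesis
    proof cases
      case 1
      with arg inner have "t = b \<or> (\<exists>w. rstep R t w \<and> rstep R b w)"
        by (auto simp: good_Fun)
      with 1 inner show ?thesis by (auto intro: rstep.arg)
    next
      case 2
      have "rstep R (Fun f (ss @ t # us)) (Fun f (ss' @ b # ws @ t # us))"
        using 2 inner rstep.arg[of R a b f ss' "ws @ t # us"] by simp
      moreover have "rstep R v (Fun f (ss' @ b # ws @ t # us))"
        using 2 inner rstep.arg[OF arg.hyps, of f "ss' @ b # ws" us] by simp
      ultimately show ?thesis by blast
    next
      case 3
      have "rstep R (Fun f (ss @ t # us)) (Fun f (ss @ t # ws @ b # us'))"
        using 3 inner rstep.arg[of R a b f "ss @ t # ws" us'] by simp
      moreover have "rstep R v (Fun f (ss @ t # ws @ b # us'))"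
        using 3 inner rstep.arg[OF arg.hyps, of f ss "ws @ b # us'"] by simp
      ultimately show ?thesis by blast
    qed
  qed
qed

end

theorem theorem3:
  fixes F S :: "'f set" and ar :: "'f \<Rightarrow> nat"
    and R :: "('f, 'v) rule set" and t u v :: "('f, 'v) trm" and m n :: nat
  assumes "trs F ar R" and "orthogonal F ar R" and "S \<subseteq> F"
    and "\<forall>p\<in>R. shape_i S p \<or> shape_ii R S p"
    and "trm_over F ar t" and "basic R t"
    and "(rstep R ^^ m) t u" and "normal_form R u"
    and "(rstep R ^^ n) t v" and "normal_form R v"
  shows "m = n"
proof -
  interpret orthogonal_shaped_trs F S ar R
    using assms by unfold_locales
  show ?thesis
  \<comment> \<open>Well-formedness belongs to the invariant because \<open>non_overlapping\<close>
    speaks only of substitutions over the signature.\<close>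
  proof (rule diamond_random_descent[where r = "rstep R" and P = "\<lambda>s. trm_over F ar s \<and> good R S s"])
    show "trm_over F ar y \<and> good R S y" if "trm_over F ar x \<and> good R S x" "rstep R x y" for x y
      using that rstep_trm_over[OF trs] rstep_good by blast
    show "y = z \<or> (\<exists>w. rstep R y w \<and> rstep R z w)"
      if "trm_over F ar x \<and> good R S x" "rstep R x y" "rstep R x z" for x y z
      using that diamond by blast
    show "trm_over F ar t \<and> good R S t"
      using assms good_basic by blast
  qed (use assms in \<open>auto simp: normal_form_def\<close>)
qed

end
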